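(* Let $H$ be a real Hilbert space and $T\colon H\to H$ a nonexpansive mapping with $\mathrm{Fix}(T)\neq\emptyset$. Suppose that $(x_n)_{n\in\mathbb{N}}$ is a sequence generated by the Line Search Fixed Point Algorithm (defined in the context) with $\beta_n=\beta_n^{\mathrm{SD}}:=0$ for all $n\in\mathbb{N}$. Then $(x_n)_{n\in\mathbb{N}}$ either terminates at a fixed point of $T$ or $$\lim_{n\to\infty}\|x_n-T(x_n)\|=0.$$ In the latter situation, $(x_n)_{n\in\mathbb{N}}$ weakly converges to a fixed point of $T$.
   Context: $\mathbb{N}=\{0,1,2,\dots\}$. $H$ has inner product $\langle\cdot,\cdot\rangle$ and induced norm $\|\cdot\|$. $T$ nonexpansive means $\|T(x)-T(y)\|\le\|x-y\|$ for all $x,y\in H$; $\mathrm{Fix}(T):=\{x\in H: T(x)=x\}$. Line Search Fixed Point Algorithm. Step 0: take $\delta,\sigma\in(0,1)$ with $\delta\le\sigma$; choose $x_0\in H$ arbitrarily, set $d_0:=-(x_0-T(x_0))$ and $n:=0$. Step 1: take $\alpha_n\in(0,1]$ satisfying the Wolfe-type conditions $$\|x_n(\alpha_n)-T(x_n(\alpha_n))\|^2-\|x_n-T(x_n)\|^2\le\delta\alpha_n\langle x_n-T(x_n),d_n\rangle,$$ $$\langle x_n(\alpha_n)-T(x_n(\alpha_n)),d_n\rangle\ge\sigma\langle x_n-T(x_n),d_n\rangle,$$ where $x_n(\alpha_n):=x_n+\alpha_n d_n$, and set $x_{n+1}:=x_n+\alpha_n d_n$. Step 2: if $\|x_{n+1}-T(x_{n+1})\|=0$,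 stop (the sequence is then said to terminate at the fixed point $x_{n+1}$). Step 3: compute $\beta_n\in\mathbb{R}$ by the chosen formula and set $d_{n+1}:=-(x_{n+1}-T(x_{n+1}))+\beta_n d_n$. Step 4: replace $n$ by $n+1$ and go to Step 1. It is assumed that step sizes $\alpha_n$ as required in Step 1 have been found at each iteration performed. *)

theory Defs
  imports "HOL-Analysis.Analysis" "HOL-Library.Extended_Nat"
begin

definition nonexpansive :: "('a::real_normed_vector \<Rightarrow> 'a) \<Rightarrow> bool" where
  "nonexpansive T \<longleftrightarrow> (\<forall>x y. norm (T x - T y) \<le> norm (x - y))"

definition Fix :: "('a \<Rightarrow> 'a) \<Rightarrow> 'a set" where
  "Fix T = {x. T x = x}"

definition weakly_converges :: "(nat \<Rightarrow> 'a::real_normed_vector) \<Rightarrow> 'a \<Rightarrow> bool" where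
  "weakly_converges x p \<longleftrightarrow>
     (\<forall>f :: 'a \<Rightarrow> real. bounded_linear f \<longrightarrow> (\<lambda>n. f (x n)) \<longlonglongrightarrow> f p)"

text \<open>The Wolfe-type conditions on a step size \<open>a\<close> at the point \<open>x\<close> in the direction \<open>d\<close>.\<close>

definition wolfe_step ::
  "('a::real_inner \<Rightarrow> 'a) \<Rightarrow> real \<Rightarrow> real \<Rightarrow> 'a \<Rightarrow> 'a \<Rightarrow> real \<Rightarrow> bool" where
  "wolfe_step T \<delta> \<sigma> x d a \<longleftrightarrow>
     (let y = x + a *\<^sub>R d in
        (norm (y - T y))\<^sup>2 - (norm (x - T x))\<^sup>2 \<le> \<delta> * a * ((x - T x) \<bullet> d) \<and>
        (y - T y) \<bullet> d \<ge> \<sigma> * ((x - T x) \<bullet> d))"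

text \<open>
  A complete run of the line search fixed point algorithm. \<open>N\<close> is the number of iterations
  performed: iteration \<open>n\<close> is performed iff \<open>n < N\<close>, and it produces \<open>x (n + 1)\<close>. The run stops
  exactly when the iterate just produced has zero residual, so \<open>N = \<infinity>\<close> means that it
  never stops and \<open>N = m\<close> that it terminates at \<open>x m\<close>. The initial point is not tested, hence
  \<open>N > 0\<close>. Nothing is said about the values of \<open>x\<close>, \<open>d\<close>, \<open>\<alpha>\<close>, \<open>\<beta>\<close> that the algorithm does not
  compute.
\<close>

definition line_search_run ::
  "('a::real_inner \<Rightarrow> 'a) \<Rightarrow> real \<Rightarrow> real \<Rightarrow> (nat \<Rightarrow> real) \<Rightarrow> (nat \<Rightarrow> real) \<Rightarrow>
   (nat \<Rightarrow> 'a) \<Rightarrow> (nat \<Rightarrow> 'a) \<Rightarrow> enat \<Rightarrow> bool" where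
  "line_search_run T \<delta> \<sigma> \<beta> \<alpha> d x N \<longleftrightarrow>
     \<delta> \<in> {0<..<1} \<and> \<sigma> \<in> {0<..<1} \<and> \<delta> \<le> \<sigma> \<and>
     N > 0 \<and>
     d 0 = - (x 0 - T (x 0)) \<and>
     (\<forall>n. enat n < N \<longrightarrow>
        \<alpha> n \<in> {0<..1} \<and>
        wolfe_step T \<delta> \<sigma> (x n) (d n) (\<alpha> n) \<and>
        x (Suc n) = x n + \<alpha> n *\<^sub>R d n \<and>
        (norm (x (Suc n) - T (x (Suc n))) = 0 \<longleftrightarrow> N = enat (Suc n)) \<and>
        (enat (Suc n) < N \<longrightarrow>
           d (Suc n) = - (x (Suc n) - T (x (Suc n))) + \<beta> n *\<^sub>R d n))"

definition beta_SD :: "nat \<Rightarrow> real" where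
  "beta_SD n = 0"

end

theory Submission
  imports Defs
begin

text \<open>
  Write \<open>r n = x n - T (x n)\<close>. The second Wolfe condition together with the 2-Lipschitz continuity of
  \<open>I - T\<close> keeps the step sizes above \<open>(1 - \<sigma>) / 2\<close>. Inserted into the first Wolfe condition, this makes
  \<open>norm (r n)\<close> decay geometrically. As \<open>norm (x (n + 1) - x n) \<le> norm (r n)\<close>, the iterates form a
  Cauchy sequence, so that they even converge strongly, and the limit is a fixed point by continuity.
\<close>

text \<open>Telescoping the triangle inequality bounds \<open>dist (x n) (x m)\<close> by the block
  \<open>sum c {m..<n}\<close>, and the Cauchy criterion for series makes such blocks small.\<close>

lemma Cauchy_if_dist_summable:
  fixes x :: "nat \<Rightarrow> 'a::metric_space" and c :: "nat \<Rightarrow> real"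
  assumes step: "\<And>n. dist (x (Suc n)) (x n) \<le> c n" and "summable c"
  shows "Cauchy x"
proof (rule metric_CauchyI)
  have dist_sum: "dist (x n) (x m) \<le> sum c {m..<n}" if "m \<le> n" for m n
    using that
  proof (induction n rule: dec_induct)
    case (step n)
    have "dist (x (Suc n)) (x m) \<le> dist (x (Suc n)) (x n) + dist (x n) (x m)"
      by (rule dist_triangle)
    then show ?case
      using step assms(1)[of n] by (simp add: sum.atLeastLessThan_Suc)
  qed simp
  fix e :: real
  assume "e > 0"
  then obtain M where M: "\<And>m n. m \<ge> M \<Longrightarrow> norm (sum c {m..<n}) < e"
    using \<open>summable c\<close> unfolding summable_Cauchy by blast
  have le: "dist (x n) (x m) < e" if "M \<le> m" "m \<le> n" for m n
    using dist_sum[OF that(2)] M[OF that(1), of n] by simp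
  have "dist (x m) (x n) < e" if "m \<ge> M" "n \<ge> M" for m n
    using le[of m n] le[of n m] that by (cases "m \<le> n") (simp_all add: dist_commute)
  then show "\<exists>M. \<forall>m\<ge>M. \<forall>n\<ge>M. dist (x m) (x n) < e" by blast
qed

lemma nonexpansive_residual_lipschitz:
  assumes "nonexpansive T"
  shows "norm ((x - T x) - (y - T y)) \<le> 2 * norm (x - y)"
proof -
  have "norm ((x - T x) - (y - T y)) = norm ((x - y) - (T x - T y))"
    by (simp add: algebra_simps)
  also have "\<dots> \<le> norm (x - y) + norm (T x - T y)"
    by (rule norm_triangle_ineq4)
  also have "\<dots> \<le> 2 * norm (x - y)"
    using assms by (simp add: nonexpansive_def)
  finally show ?thesis .
qed

text \<open>Along the direction \<open>- r\<close> the curvature condition forces the new residual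
  \<open>s\<close> away from \<open>r\<close>. Residuals change at most twice as fast as points, and
  the point moves by \<open>a * norm r\<close>, so \<open>a\<close> cannot be small. The decrease
  condition turns this lower bound on \<open>a\<close> into the factor.\<close>

lemma wolfe_step_residual_contraction:
  fixes T :: "'a::real_inner \<Rightarrow> 'a"
  assumes "nonexpansive T" "\<delta> \<ge> 0" "a \<ge> 0"
    and wolfe: "wolfe_step T \<delta> \<sigma> x (- (x - T x)) a"
    and y: "y = x - a *\<^sub>R (x - T x)"
  shows "(norm (y - T y))\<^sup>2 \<le> (1 - \<delta> * (1 - \<sigma>) / 2) * (norm (x - T x))\<^sup>2"
proof -
  define r s where "r = x - T x" and "s = y - T y"
  have "x + a *\<^sub>R (- r) = y"
    unfolding y r_def[symmetric] by simp
  then have decrease: "(norm s)\<^sup>2 \<le> (norm r)\<^sup>2 - \<delta> * a * (norm r)\<^sup>2"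
    and curvature: "s \<bullet> r \<le> \<sigma> * (norm r)\<^sup>2"
    using wolfe unfolding wolfe_step_def Let_def r_def[symmetric]
    by (simp_all add: s_def dot_square_norm)
  have "(1 - \<sigma>) * (norm r)\<^sup>2 \<le> (r - s) \<bullet> r"
    using curvature by (simp add: inner_diff_left dot_square_norm algebra_simps)
  also have "\<dots> \<le> norm (r - s) * norm r"
    by (rule norm_cauchy_schwarz)
  also have "\<dots> \<le> (2 * norm (x - y)) * norm r"
    unfolding r_def s_def
    by (intro mult_right_mono nonexpansive_residual_lipschitz assms) simp
  also have "\<dots> = 2 * a * (norm r)\<^sup>2"
    using \<open>a \<ge> 0\<close> by (simp add: y r_def[symmetric] power2_eq_square)
  \<comment> \<open>This is \<open>a \<ge> (1 - \<sigma>) / 2\<close> multiplied by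
    \<open>(norm r)\<^sup>2\<close>. Keeping that factor avoids a separate case for
    \<open>r = 0\<close>.\<close>
  finally have "(1 - \<sigma>) / 2 * (norm r)\<^sup>2 \<le> a * (norm r)\<^sup>2"
    by simp
  then have "\<delta> * ((1 - \<sigma>) / 2 * (norm r)\<^sup>2) \<le> \<delta> * (a * (norm r)\<^sup>2)"
    using \<open>\<delta> \<ge> 0\<close> by (rule mult_left_mono)
  then show ?thesis
    using decrease unfolding r_def[symmetric] s_def[symmetric] by (simp add: field_simps)
qed

lemma line_search_run_SD_infinite_converges:
  fixes T :: "'a::{real_inner, complete_space} \<Rightarrow> 'a"
  assumes ne: "nonexpansive T"
    and run: "line_search_run T \<delta> \<sigma> beta_SD \<alpha> d x \<infinity>"
  obtains p where "p \<in> Fix T" "x \<longlonglongrightarrow> p" "(\<lambda>n. norm (x n - T (x n))) \<longlonglongrightarrow> 0"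
proof -
  define r where "r n = x n - T (x n)" for n
  have \<delta>: "0 < \<delta>" "\<delta> < 1" and \<sigma>: "0 < \<sigma>" "\<sigma> < 1"
    and \<alpha>: "0 < \<alpha> n" "\<alpha> n \<le> 1"
    and wolfe: "wolfe_step T \<delta> \<sigma> (x n) (d n) (\<alpha> n)"
    and x_Suc: "x (Suc n) = x n + \<alpha> n *\<^sub>R d n" for n
    using run unfolding line_search_run_def by auto
  \<comment> \<open>The initialization covers \<open>n = 0\<close>. For successors the guard
    \<open>enat (Suc n) < N\<close> always holds in an infinite run, and the zero coefficient
    removes the previous direction.\<close>
  have d: "d n = - r n" for n
    using run unfolding line_search_run_def by (cases n) (auto simp: beta_SD_def r_def)

  \<comment> \<open>The contraction estimate concerns squared norms, hence the root. Since
    \<open>\<delta> * (1 - \<sigma>)\<close> lies strictly between 0 and 1, the radicand lies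
    between 1/2 and 1.\<close>
  define q where "q = sqrt (1 - \<delta> * (1 - \<sigma>) / 2)"
  have "0 < \<delta> * (1 - \<sigma>)" "\<delta> * (1 - \<sigma>) < 1"
    using \<delta> \<sigma> mult_strict_mono[of \<delta> 1 "1 - \<sigma>" 1] by simp_all
  then have q: "0 \<le> q" "q < 1" and q_sq: "q\<^sup>2 = 1 - \<delta> * (1 - \<sigma>) / 2"
    by (simp_all add: q_def)

  have contr: "norm (r (Suc n)) \<le> q * norm (r n)" for n
  proof (rule power2_le_imp_le)
    have "x (Suc n) = x n - \<alpha> n *\<^sub>R (x n - T (x n))"
      using x_Suc[of n] unfolding d r_def[symmetric] by simp
    then show "(norm (r (Suc n)))\<^sup>2 \<le> (q * norm (r n))\<^sup>2"
      using wolfe_step_residual_contraction[OF ne _ _ wolfe[of n, unfolded d r_def]] \<delta> \<alpha>(1)[of n]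
      unfolding r_def power_mult_distrib q_sq by (simp only: less_imp_le)
  qed (use q in simp)
  have geometric: "norm (r n) \<le> norm (r 0) * q ^ n" for n
  proof (induction n)
    case (Suc n)
    show ?case
      using contr[of n] mult_left_mono[OF Suc q(1)] by (simp add: mult_ac)
  qed simp
  have summable: "summable (\<lambda>n. norm (r 0) * q ^ n)"
    using q by (intro summable_mult summable_geometric) simp
  have r_lim: "(\<lambda>n. norm (r n)) \<longlonglongrightarrow> 0"
    using geometric
    by (intro tendsto_sandwich[OF _ _ tendsto_const summable_LIMSEQ_zero[OF summable]]) simp_all

  \<comment> \<open>The upper bound \<open>\<alpha> n \<le> 1\<close> lets the residual dominate the
    length of the step.\<close>
  have "dist (x (Suc n)) (x n) \<le> norm (r 0) * q ^ n" for n
  proof -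
    have "dist (x (Suc n)) (x n) = \<alpha> n * norm (r n)"
      using \<alpha>(1)[of n] by (simp add: x_Suc d dist_norm)
    also have "\<dots> \<le> norm (r n)"
      using \<alpha>[of n] by (simp add: mult_left_le_one_le)
    finally show ?thesis
      using geometric[of n] by linarith
  qed
  then have "Cauchy x"
    using summable by (rule Cauchy_if_dist_summable)
  then obtain p where p: "x \<longlonglongrightarrow> p"
    using Cauchy_convergent_iff convergent_def by blast
  \<comment> \<open>Nonexpansiveness gives continuity of \<open>T\<close> at \<open>p\<close>, so
    the residuals tend to \<open>p - T p\<close> as well as to 0.\<close>
  have "(\<lambda>n. T (x n)) \<longlonglongrightarrow> T p"
  proof (rule Lim_transform_bound[of _ "\<lambda>n. x n - p", THEN Lim_null[THEN iffD2]])
    show "\<forall>\<^sub>F n in sequentially. norm (T (x n) - T p) \<le> norm (x n - p)"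
      using ne by (simp add: nonexpansive_def)
    show "(\<lambda>n. x n - p) \<longlonglongrightarrow> 0"
      using p by (simp add: Lim_null[symmetric])
  qed
  then have "r \<longlonglongrightarrow> p - T p"
    unfolding r_def by (intro tendsto_diff p)
  then have "p - T p = 0"
    using r_lim LIMSEQ_unique tendsto_norm_zero_iff by blast
  then have "p \<in> Fix T"
    by (simp add: Fix_def)
  then show thesis
    using that p r_lim by (simp add: r_def)
qed

theorem theorem2p1:
  fixes T :: "'a::{real_inner, complete_space} \<Rightarrow> 'a"
    and \<delta> \<sigma> :: real and \<alpha> :: "nat \<Rightarrow> real" and d x :: "nat \<Rightarrow> 'a" and N :: enat
  assumes "nonexpansive T"
    and "Fix T \<noteq> {}"
    and "line_search_run T \<delta> \<sigma> beta_SD \<alpha> d x N"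
  shows "((\<exists>m. N = enat m \<and> x m \<in> Fix T) \<or>
          (N = \<infinity> \<and> (\<lambda>n. norm (x n - T (x n))) \<longlonglongrightarrow> 0)) \<and>
         (N = \<infinity> \<and> (\<lambda>n. norm (x n - T (x n))) \<longlonglongrightarrow> 0 \<longrightarrow>
            (\<exists>p\<in>Fix T. weakly_converges x p))"
proof (cases N)
  case (enat m)
  \<comment> \<open>Since \<open>N > 0\<close>, there is a last iteration \<open>k\<close>, and its
    stopping test says that the residual at \<open>x (Suc k)\<close> vanishes.\<close>
  then obtain k where m: "m = Suc k"
    using assms(3) unfolding line_search_run_def by (cases m) (auto simp: zero_enat_def)
  then have "norm (x m - T (x m)) = 0"
    using assms(3) enat unfolding line_search_run_def by auto
  then have "x m \<in> Fix T"
    by (simp add: Fix_def)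
  then show ?thesis
    using enat by simp
next
  case infinity
  then obtain p where p: "p \<in> Fix T" "x \<longlonglongrightarrow> p" "(\<lambda>n. norm (x n - T (x n))) \<longlonglongrightarrow> 0"
    using line_search_run_SD_infinite_converges assms by blast
  \<comment> \<open>Bounded linear functionals are continuous, so they preserve the strong
    limit.\<close>
  have "weakly_converges x p"
    using p(2) by (auto simp: weakly_converges_def intro: bounded_linear.tendsto)
  then show ?thesis
    using infinity p by blast
qed

end
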